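(* Let $N\ge1$, $p>1$, $A>0$, and let $\varphi\in L^\infty(D)$ be nonnegative with $\varphi(x)\ge(1+|x|)^{-A}$ for $x\in D$. (i) Let $p=p_*$ and $A\ge1/(p-1)=N$. Then there exists $\gamma>0$ such that for all sufficiently small $\kappa>0$: $\log T(\kappa\varphi)\le\gamma\kappa^{-(p-1)}$ if $A>N$, and $\log T(\kappa\varphi)\le\gamma\kappa^{-\frac{p-1}{p}}$ if $A=N$. (ii) Let $1<p<p_*$ or $A<1/(p-1)$. Then there exists $\gamma'>0$ such that for all sufficiently small $\kappa>0$: $T(\kappa\varphi)\le\gamma'\kappa^{-\left(\frac{1}{2(p-1)}-\frac12\min\{A,N\}\right)^{-1}}$ if $A\ne N$, and $T(\kappa\varphi)\le\gamma'\Big(\frac{\kappa^{-1}}{\log(\kappa^{-1})}\Big)^{\left(\frac{1}{2(p-1)}-\frac N2\right)^{-1}}$ if $A=N$.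
   Context: Let $p_*:=1+\frac1N$. Write $x=(x',x_N)$, $\mathbf{R}^N_+=\{x_N>0\}$, $D:=\overline{\mathbf{R}^N_+}$, identifying $\partial\mathbf{R}^N_+$ with $\mathbf{R}^{N-1}$. Let $\Gamma_N(x,t)=(4\pi t)^{-N/2}e^{-|x|^2/(4t)}$, $G(x,y,t):=\Gamma_N(x-y,t)+\Gamma_N(x-y_*,t)$, $y_*=(y',-y_N)$, $[S(t)\mu](x):=\int_DG(x,y,t)\,d\mu(y)$. A nonnegative continuous $u$ on $D\times(0,T)$ is a solution of the initial-boundary problem ($\partial_tu=\Delta u$ in $\mathbf{R}^N_+$, $\partial_\nu u=u^p$ on $\partial\mathbf{R}^N_+$, $u(\cdot,0)=\mu$) in $[0,T)$ if $u(x,t)=[S(t)\mu](x)+\int_0^t\int_{\mathbf{R}^{N-1}}G(x,(y',0),t-s)u(y',0,s)^p\,dy'\,ds$ on $D\times(0,T)$; it is minimal if it lies below every other solution in $[0,T)$. The life span $T(\mu)\in[0,\infty]$ is the maximal existence time of the minimal solution. *)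

theory Defs
  imports "HOL-Analysis.Analysis"
begin

text \<open>Points of R^N are represented as extensional functions on the index set {..<N}
  (coordinates 0..N-1; the last coordinate N-1 is x_N). Lebesgue measure on R^N is the
  completion of the N-fold product of the Lebesgue-Borel measure.\<close>

definition lebN :: "nat \<Rightarrow> (nat \<Rightarrow> real) measure" where
  "lebN N = completion (PiM {..<N} (\<lambda>_. lborel))"

definition sqdistN :: "nat \<Rightarrow> (nat \<Rightarrow> real) \<Rightarrow> (nat \<Rightarrow> real) \<Rightarrow> real" where
  "sqdistN N x y = (\<Sum>i<N. (x i - y i)^2)"

definition normN :: "nat \<Rightarrow> (nat \<Rightarrow> real) \<Rightarrow> real" where
  "normN N x = sqrt (\<Sum>i<N. (x i)^2)"

definition halfD :: "nat \<Rightarrow> (nat \<Rightarrow> real) set" where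
  "halfD N = {x \<in> space (PiM {..<N} (\<lambda>_. lborel)). x (N - 1) \<ge> 0}"

definition reflN :: "nat \<Rightarrow> (nat \<Rightarrow> real) \<Rightarrow> (nat \<Rightarrow> real)" where
  "reflN N y = y(N - 1 := - y (N - 1))"

definition bdpt :: "nat \<Rightarrow> (nat \<Rightarrow> real) \<Rightarrow> (nat \<Rightarrow> real)" where
  "bdpt N y' = y'(N - 1 := 0)"

definition GammaN :: "nat \<Rightarrow> (nat \<Rightarrow> real) \<Rightarrow> (nat \<Rightarrow> real) \<Rightarrow> real \<Rightarrow> real" where
  "GammaN N x y t = (4 * pi * t) powr (- real N / 2) * exp (- sqdistN N x y / (4 * t))"

definition Gker :: "nat \<Rightarrow> (nat \<Rightarrow> real) \<Rightarrow> (nat \<Rightarrow> real) \<Rightarrow> real \<Rightarrow> real" where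
  "Gker N x y t = GammaN N x y t + GammaN N x (reflN N y) t"

text \<open>[S(t) mu](x) for mu = f dx with f nonnegative\<close>
definition Sheat :: "nat \<Rightarrow> ((nat \<Rightarrow> real) \<Rightarrow> real) \<Rightarrow> real \<Rightarrow> (nat \<Rightarrow> real) \<Rightarrow> ennreal" where
  "Sheat N f t x = (\<integral>\<^sup>+ y. indicator (halfD N) y * ennreal (Gker N x y t * f y) \<partial>lebN N)"

definition Duhamel :: "nat \<Rightarrow> real \<Rightarrow> ((nat \<Rightarrow> real) \<Rightarrow> real \<Rightarrow> real) \<Rightarrow> (nat \<Rightarrow> real) \<Rightarrow> real \<Rightarrow> ennreal" where
  "Duhamel N p u x t = (\<integral>\<^sup>+ s. indicator {0<..<t} s *
       (\<integral>\<^sup>+ y'. ennreal (Gker N x (bdpt N y') (t - s) * (u (bdpt N y') s) powr p) \<partial>lebN (N - 1))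
     \<partial>lborel)"

definition is_solution :: "nat \<Rightarrow> real \<Rightarrow> ((nat \<Rightarrow> real) \<Rightarrow> real) \<Rightarrow> ereal \<Rightarrow> ((nat \<Rightarrow> real) \<Rightarrow> real \<Rightarrow> real) \<Rightarrow> bool" where
  "is_solution N p f T u \<longleftrightarrow>
     continuous_on (halfD N \<times> {t. 0 < t \<and> ereal t < T}) (\<lambda>(x, t). u x t) \<and>
     (\<forall>x \<in> halfD N. \<forall>t. 0 < t \<and> ereal t < T \<longrightarrow>
        0 \<le> u x t \<and> ennreal (u x t) = Sheat N f t x + Duhamel N p u x t)"

definition is_minimal_solution :: "nat \<Rightarrow> real \<Rightarrow> ((nat \<Rightarrow> real) \<Rightarrow> real) \<Rightarrow> ereal \<Rightarrow> ((nat \<Rightarrow> real) \<Rightarrow> real \<Rightarrow> real) \<Rightarrow> bool" where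
  "is_minimal_solution N p f T u \<longleftrightarrow> is_solution N p f T u \<and>
     (\<forall>v. is_solution N p f T v \<longrightarrow>
        (\<forall>x \<in> halfD N. \<forall>t. 0 < t \<and> ereal t < T \<longrightarrow> u x t \<le> v x t))"

definition lifespan :: "nat \<Rightarrow> real \<Rightarrow> ((nat \<Rightarrow> real) \<Rightarrow> real) \<Rightarrow> ereal" where
  "lifespan N p f = Sup {T. 0 \<le> T \<and> (\<exists>u. is_minimal_solution N p f T u)}"

end

theory Submission
  imports Defs "HOL-Real_Asymp.Real_Asymp"
begin

text \<open>For 0 < s < t the boundary cube of half-side sqrt s is within distance sqrt (t - s), in each
coordinate, of every point of the boundary cube of half-side sqrt t. Consequently a lower bound
u \<ge> K s^(-N/2) on these cubes for all times s \<ge> a improves, through the Duhamel term and after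
replacing s^b by a lower bound B, to u \<ge> c B K^p log (a'/a) t^(-N/2) for times t \<ge> a', where
b = (1 - N (p - 1)) / 2. The iteration starts with a value K = m which is a constant times the mass of
the initial datum in a cube of side sqrt a. Doubling K costs a geometrically decreasing amount of
logarithmic time, so u would be infinite before time L unless B m^(p-1) log (L/a) is bounded by a
constant. The life span estimates follow with a = 1 (critical exponent, fast decay), a = sqrt L
(critical exponent, A = N) and a = L/2 (all other cases).\<close>

section \<open>Boxes, boundary cubes and the heat kernel at parabolic distance\<close>

definition boxN :: "nat \<Rightarrow> (nat \<Rightarrow> real) \<Rightarrow> real \<Rightarrow> (nat \<Rightarrow> real) set" where
  "boxN n \<alpha> h = (\<Pi>\<^sub>E i\<in>{..<n}. {\<alpha> i..\<alpha> i + h})"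

definition bdcube :: "nat \<Rightarrow> real \<Rightarrow> (nat \<Rightarrow> real) set" where
  "bdcube N r = {x \<in> halfD N. x (N - 1) = 0 \<and> (\<forall>i<N. \<bar>x i\<bar> \<le> r)}"

text \<open>The value of the Gaussian at time 1 and squared distance 4 N, which is the largest
  squared distance left by coordinate differences of at most 2.\<close>

definition heat_const :: "nat \<Rightarrow> real" where
  "heat_const N = (4 * pi) powr (- real N / 2) * exp (- real N)"

text \<open>The cube has a corner at the origin, so for N \<ge> 1 it lies inside
  \<open>halfD N\<close> and need not be intersected with the half space.\<close>

definition mass :: "nat \<Rightarrow> real \<Rightarrow> real \<Rightarrow> ennreal" where
  "mass N A R = (\<integral>\<^sup>+ y. ennreal ((1 + normN N y) powr (- A)) * indicator (boxN N (\<lambda>_. 0) R) y \<partial>lebN N)"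

lemma heat_const_pos: "heat_const N > 0"
  by (simp add: heat_const_def)

lemma box_sets_PiM: "boxN n \<alpha> h \<in> sets (PiM {..<n} (\<lambda>_. lborel))"
  unfolding boxN_def by (intro sets_PiM_I_finite) auto

lemma box_sets [measurable]: "boxN n \<alpha> h \<in> sets (lebN n)"
  unfolding lebN_def using box_sets_PiM by (rule sets_completionI_sets)

lemma emeasure_box:
  assumes "h \<ge> 0"
  shows "emeasure (lebN n) (boxN n \<alpha> h) = ennreal (h ^ n)"
proof -
  interpret product_sigma_finite "\<lambda>_::nat. lborel :: real measure" ..
  have "emeasure (lebN n) (boxN n \<alpha> h) = emeasure (PiM {..<n} (\<lambda>_. lborel)) (boxN n \<alpha> h)"
    unfolding lebN_def by (simp add: box_sets_PiM)
  also have "\<dots> = (\<Prod>i<n. emeasure lborel {\<alpha> i..\<alpha> i + h})"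
    unfolding boxN_def by (rule emeasure_PiM) auto
  also have "\<dots> = ennreal (h ^ n)"
    using assms by (simp add: ennreal_power)
  finally show ?thesis .
qed

text \<open>The nonnegative integral is monotone for arbitrary integrands, so this bound applies
  directly to the inner integrand of \<open>Duhamel\<close>.\<close>

lemma nn_integral_box_ge:
  assumes "h \<ge> 0" "c \<ge> 0" and ge: "\<And>y. y \<in> boxN n \<alpha> h \<Longrightarrow> ennreal c \<le> f y"
  shows "ennreal (c * h ^ n) \<le> (\<integral>\<^sup>+ y. f y \<partial>lebN n)"
proof -
  have "ennreal (c * h ^ n) = (\<integral>\<^sup>+ y. ennreal c * indicator (boxN n \<alpha> h) y \<partial>lebN n)"
    using assms by (simp add: nn_integral_cmult_indicator emeasure_box ennreal_mult)
  also have "\<dots> \<le> (\<integral>\<^sup>+ y. f y \<partial>lebN n)"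
    by (intro nn_integral_mono) (auto simp: indicator_def ge)
  finally show ?thesis .
qed

lemma GammaN_nonneg: "GammaN N x y t \<ge> 0"
  by (simp add: GammaN_def)

text \<open>Each coordinate contributes at most 4 t to the squared distance, so the exponent of the
  direct Gaussian is at least -N. The reflected Gaussian is nonnegative and is dropped.\<close>

lemma Gker_ge:
  assumes t: "t > 0" and d: "\<And>i. i < N \<Longrightarrow> \<bar>x i - y i\<bar> \<le> 2 * sqrt t"
  shows "heat_const N * t powr (- real N / 2) \<le> Gker N x y t"
proof -
  have "sqdistN N x y \<le> (\<Sum>i<N. 4 * t)"
    unfolding sqdistN_def
  proof (rule sum_mono)
    fix i assume "i \<in> {..<N}"
    then have "\<bar>x i - y i\<bar>^2 \<le> (2 * sqrt t)^2" using d by (intro power_mono) auto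
    then show "(x i - y i)^2 \<le> 4 * t" using t by (simp add: power_mult_distrib)
  qed
  then have "- real N \<le> - sqdistN N x y / (4 * t)"
    using t by (simp add: field_simps)
  then have "heat_const N * t powr (- real N / 2) \<le> GammaN N x y t"
    using t by (simp add: heat_const_def GammaN_def powr_mult mult.commute mult.left_commute mult_left_mono)
  then show ?thesis
    using GammaN_nonneg[of N x "reflN N y" t] by (simp add: Gker_def)
qed

lemma bdcube_zero: "N \<ge> 1 \<Longrightarrow> r \<ge> 0 \<Longrightarrow> restrict (\<lambda>_. 0) {..<N} \<in> bdcube N r"
  by (auto simp: bdcube_def halfD_def space_PiM)

section \<open>Lower bounds for a solution and their iteration\<close>

lemma solution_ge:
  assumes "is_solution N p f T u" "ereal t < T" "0 < t" "x \<in> halfD N"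
  shows "Sheat N f t x \<le> ennreal (u x t)" "Duhamel N p u x t \<le> ennreal (u x t)" "0 \<le> u x t"
  using assms unfolding is_solution_def by auto

lemma weight_measurable [measurable]:
  "(\<lambda>y. ennreal ((1 + normN N y) powr (- A))) \<in> borel_measurable (lebN N)"
proof -
  have "(\<lambda>y. ennreal ((1 + normN N y) powr (- A))) \<in> borel_measurable (PiM {..<N} (\<lambda>_. lborel))"
    unfolding normN_def by measurable
  then show ?thesis unfolding lebN_def by (rule measurable_completion)
qed

text \<open>This is the start of the iteration. The coordinates of x are at most sqrt t in absolute
  value and those of y in the cube of side sqrt a lie between 0 and sqrt t, so
  \<open>Gker_ge\<close> applies on the whole cube and the integral of the datum over it is at least
  \<kappa> M.\<close>

lemma solution_lower_init:
  assumes sol: "is_solution N p (\<lambda>x. \<kappa> * \<phi> x) T u" and T: "ereal t < T"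
    and a: "0 < a" "a \<le> t" and \<kappa>: "\<kappa> > 0"
    and lower: "\<And>x. x \<in> halfD N \<Longrightarrow> (1 + normN N x) powr (- A) \<le> \<phi> x"
    and M: "ennreal M \<le> mass N A (sqrt a)" "M \<ge> 0"
    and N: "N \<ge> 1" and x: "x \<in> bdcube N (sqrt t)"
  shows "heat_const N * \<kappa> * M * t powr (- real N / 2) \<le> u x t"
proof -
  let ?c = "heat_const N * t powr (- real N / 2) * \<kappa>"
  let ?w = "\<lambda>y. (1 + normN N y) powr (- A)"
  have c: "?c \<ge> 0" using heat_const_pos[of N] \<kappa> by simp
  have t: "t > 0" using a by simp
  have box_half: "y \<in> halfD N" if "y \<in> boxN N (\<lambda>_. 0) r" for y r
    using that N by (auto simp: boxN_def halfD_def space_PiM PiE_iff)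
  have "ennreal (?c * M) \<le> ennreal ?c * mass N A (sqrt a)"
    using c M by (simp add: ennreal_mult mult_left_mono)
  also have "\<dots> = (\<integral>\<^sup>+ y. ennreal ?c * (ennreal (?w y) * indicator (boxN N (\<lambda>_. 0) (sqrt a)) y) \<partial>lebN N)"
    unfolding mass_def by (rule nn_integral_cmult[symmetric]) measurable
  also have "\<dots> \<le> Sheat N (\<lambda>x. \<kappa> * \<phi> x) t x"
    unfolding Sheat_def
  proof (rule nn_integral_mono)
    fix y
    show "ennreal ?c * (ennreal (?w y) * indicator (boxN N (\<lambda>_. 0) (sqrt a)) y)
       \<le> indicator (halfD N) y * ennreal (Gker N x y t * (\<kappa> * \<phi> y))"
    proof (cases "y \<in> boxN N (\<lambda>_. 0) (sqrt a)")
      case True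
      have G: "heat_const N * t powr (- real N / 2) \<le> Gker N x y t"
      proof (rule Gker_ge[OF t])
        fix i assume i: "i < N"
        have "0 \<le> y i" "y i \<le> sqrt a" using True i by (auto simp: boxN_def PiE_iff)
        moreover have "\<bar>x i\<bar> \<le> sqrt t" using x i by (auto simp: bdcube_def)
        moreover have "sqrt a \<le> sqrt t" using a by simp
        ultimately show "\<bar>x i - y i\<bar> \<le> 2 * sqrt t" by linarith
      qed
      have "?c * ?w y = (heat_const N * t powr (- real N / 2)) * (\<kappa> * ?w y)" by simp
      also have "\<dots> \<le> Gker N x y t * (\<kappa> * \<phi> y)"
        using G lower[OF box_half[OF True]] \<kappa> heat_const_pos[of N]
        by (intro mult_mono) (auto intro!: order_trans[OF _ G])
      finally show ?thesis
        using True box_half[OF True] c by (simp add: ennreal_mult[symmetric] ennreal_leI)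
    qed simp
  qed
  also have "\<dots> \<le> ennreal (u x t)"
    using solution_ge(1)[OF sol T t] x by (auto simp: bdcube_def)
  finally have "?c * M \<le> u x t"
    using solution_ge(3)[OF sol T t] x by (simp add: bdcube_def)
  then show ?thesis by (simp add: ac_simps)
qed

text \<open>Since sqrt t \<le> sqrt s + sqrt (t - s), the point of [-sqrt s, sqrt s] nearest to x is
  within sqrt (t - s) of x. An interval of length \<eta> starting there and pointing towards the
  other end costs at most another sqrt (t - s). The length \<eta> lies below both sqrt s and sqrt (t
  - s) and, unlike their minimum, is a product of powers of s, t - s and t.\<close>

lemma interval_choice:
  fixes x s t :: real
  assumes "0 < s" "s < t" "\<bar>x\<bar> \<le> sqrt t"
  defines "\<eta> \<equiv> sqrt (s * (t - s) / t)"
  shows "\<exists>\<alpha>. \<forall>y\<in>{\<alpha>..\<alpha> + \<eta>}. \<bar>y\<bar> \<le> sqrt s \<and> \<bar>x - y\<bar> \<le> 2 * sqrt (t - s)"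
proof -
  have sub: "sqrt t \<le> sqrt s + sqrt (t - s)"
    using sqrt_add_le_add_sqrt[of s "t - s"] assms by simp
  have "s * (t - s) \<le> s * t" "s * (t - s) \<le> (t - s) * t"
    using assms by (simp_all add: mult_left_mono mult_right_mono mult.commute)
  then have "s * (t - s) / t \<le> s" "s * (t - s) / t \<le> t - s"
    using assms by (simp_all add: pos_divide_le_eq)
  then have e: "\<eta> \<le> sqrt s" "\<eta> \<le> sqrt (t - s)"
    unfolding \<eta>_def by auto
  have pos: "sqrt s \<ge> 0" "sqrt (t - s) \<ge> 0" "\<eta> \<ge> 0" using assms by (auto simp: \<eta>_def)
  show ?thesis
  proof (cases "x \<ge> 0")
    case True
    show ?thesis
      \<comment> \<open>The nearest point is the right end here; in the other case it is the left
        end.\<close>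
      by (rule exI[of _ "min x (sqrt s) - \<eta>"]) (use True sub e pos assms(3) in \<open>auto simp: min_def abs_if\<close>)
  next
    case False
    show ?thesis
      by (rule exI[of _ "max x (- sqrt s)"]) (use False sub e pos assms(3) in \<open>auto simp: max_def abs_if\<close>)
  qed
qed

text \<open>The last factor is the volume of the (N-1)-dimensional box of side \<eta>. The powers of
  s combine to s^(b - 1) with b = (1 - N (p - 1)) / 2, hence are at least B / s. The powers of t - s
  combine to (t - s)^(-1/2) \<ge> t^(-1/2), which together with the factor t^(-(N - 1)/2) of the
  volume gives t^(-N/2).\<close>

lemma step_exponents:
  fixes s t K p :: real
  assumes s: "0 < s" "s < t" and K: "K \<ge> 0" and N: "N \<ge> 1" and p: "p > 1"
    and B: "B \<le> s powr ((1 - real N * (p - 1)) / 2)"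
  shows "K powr p * t powr (- real N / 2) * (B / s)
    \<le> ((t - s) powr (- real N / 2) * (K * s powr (- real N / 2)) powr p) * sqrt (s * (t - s) / t) ^ (N - 1)"
proof -
  let ?n = "real N"
  have ts: "t - s > 0" "t > 0" using s by auto
  have eta: "sqrt (s * (t - s) / t) ^ (N - 1) = s powr ((?n-1)/2) * (t-s) powr ((?n-1)/2) * t powr (-(?n-1)/2)"
  proof -
    have gen: "(s * (t - s) / t) powr e = s powr e * (t-s) powr e * t powr (- e)" for e
      using s ts by (simp add: powr_divide powr_mult powr_minus_divide)
    have "sqrt (s * (t - s) / t) ^ (N - 1) = sqrt (s * (t - s) / t) powr (?n - 1)"
      using s ts N by (subst powr_realpow[symmetric]) (auto simp: of_nat_diff)
    also have "\<dots> = (s * (t - s) / t) powr ((?n-1)/2)"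
      using s ts by (simp add: powr_half_sqrt[symmetric] powr_powr)
    also have "\<dots> = s powr ((?n-1)/2) * (t-s) powr ((?n-1)/2) * t powr (-(?n-1)/2)"
      using gen[of "(?n-1)/2"] by (simp only: minus_divide_left)
    finally show ?thesis .
  qed
  have "B / s \<le> s powr ((1 - ?n * (p - 1)) / 2) / s"
    using B s by (simp add: divide_right_mono)
  also have "\<dots> = s powr ((1 - ?n * (p - 1)) / 2 - 1)"
    using s by (simp add: powr_diff)
  also have "(1 - ?n * (p - 1)) / 2 - 1 = - ?n/2 * p + (?n-1)/2"
    by (simp add: field_simps)
  finally have 1: "B / s \<le> s powr (- ?n/2 * p) * s powr ((?n-1)/2)"
    by (simp only: powr_add)
  have 2: "t powr (- ?n / 2) \<le> (t-s) powr (- ?n / 2) * (t-s) powr ((?n-1)/2) * t powr (-(?n-1)/2)"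
  proof -
    have "t powr (- ?n / 2) = t powr (-1/2) * t powr (-(?n-1)/2)"
      by (simp add: powr_add[symmetric] field_simps)
    also have "\<dots> \<le> (t-s) powr (-1/2) * t powr (-(?n-1)/2)"
      using s ts by (intro mult_right_mono powr_mono2') auto
    also have "(t-s) powr (-1/2) = (t-s) powr (- ?n / 2) * (t-s) powr ((?n-1)/2)"
      by (simp add: powr_add[symmetric] field_simps)
    finally show ?thesis .
  qed
  have "K powr p * t powr (- ?n / 2) * (B / s) \<le> K powr p * (t powr (- ?n / 2) * (s powr (- ?n/2 * p) * s powr ((?n-1)/2)))"
    unfolding mult.assoc using 1 by (intro mult_left_mono) auto
  also have "\<dots> \<le> K powr p * (((t-s) powr (- ?n / 2) * (t-s) powr ((?n-1)/2) * t powr (-(?n-1)/2)) * (s powr (- ?n/2 * p) * s powr ((?n-1)/2)))"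
    using 2 by (intro mult_left_mono mult_right_mono) auto
  also have "\<dots> = ((t - s) powr (- ?n / 2) * (K powr p * s powr (- ?n / 2 * p))) * sqrt (s * (t - s) / t) ^ (N - 1)"
    unfolding eta by (simp only: ac_simps)
  also have "K powr p * s powr (- ?n / 2 * p) = (K * s powr (- ?n / 2)) powr p"
    using K by (simp add: powr_mult powr_powr)
  finally show ?thesis .
qed

lemma nn_integral_inverse:
  assumes "0 < a" "a \<le> b"
  shows "(\<integral>\<^sup>+ s. ennreal (1 / s) * indicator {a..b} s \<partial>lborel) = ennreal (ln (b / a))"
proof -
  have "(\<integral>\<^sup>+ s. ennreal (1 / s) * indicator {a..b} s \<partial>lborel) = ennreal (ln b - ln a)"
    by (rule nn_integral_FTC_Icc[where F=ln])
      (use assms in \<open>auto intro!: derivative_eq_intros simp: has_real_derivative_iff_has_vector_derivative[symmetric] inverse_eq_divide\<close>)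
  then show ?thesis using assms by (simp add: ln_div)
qed

text \<open>At each time s in [a, t) the inner integral over a suitable boundary box of side \<eta>
  is at least a constant times 1/s. Keeping only the times in [a, a'] of the Duhamel integral
  produces the logarithm.\<close>

lemma solution_lower_step:
  assumes sol: "is_solution N p f T u" and LT: "ereal L < T"
    and N: "N \<ge> 1" and p: "p > 1" and K: "K \<ge> 0" and a: "0 < a" "a \<le> a'" and B0: "B \<ge> 0"
    and B: "\<And>s. a \<le> s \<Longrightarrow> s \<le> L \<Longrightarrow> B \<le> s powr ((1 - real N * (p - 1)) / 2)"
    and low: "\<And>s y. a \<le> s \<Longrightarrow> s \<le> L \<Longrightarrow> y \<in> bdcube N (sqrt s) \<Longrightarrow> K * s powr (- real N / 2) \<le> u y s"
    and t: "a' \<le> t" "t \<le> L" and x: "x \<in> bdcube N (sqrt t)"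
  shows "heat_const N * B * K powr p * ln (a' / a) * t powr (- real N / 2) \<le> u x t"
proof -
  let ?C = "heat_const N * K powr p * t powr (- real N / 2) * B"
  have C: "?C \<ge> 0" using heat_const_pos[of N] B0 by simp
  have t0: "t > 0" using a t by simp
  have tT: "ereal t < T" using t(2) LT by (meson ereal_less_eq(3) order_le_less_trans)
  have inner: "ennreal (?C * (1 / s)) \<le> (\<integral>\<^sup>+ y'. ennreal (Gker N x (bdpt N y') (t - s) * (u (bdpt N y') s) powr p) \<partial>lebN (N - 1))"
    if s: "a \<le> s" "s < t" for s
  proof -
    have s0: "0 < s" using a s by simp
    define \<eta> where "\<eta> = sqrt (s * (t - s) / t)"
    \<comment> \<open>The corner of the box is chosen coordinate by coordinate; only its first N - 1
      coordinates enter \<open>boxN (N - 1) \<alpha> \<eta>\<close>.\<close>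
    have "\<forall>i\<in>{..<N}. \<exists>\<alpha>. \<forall>y\<in>{\<alpha>..\<alpha> + \<eta>}. \<bar>y\<bar> \<le> sqrt s \<and> \<bar>x i - y\<bar> \<le> 2 * sqrt (t - s)"
      using x unfolding \<eta>_def by (intro ballI interval_choice[OF s0 s(2)]) (auto simp: bdcube_def)
    then obtain \<alpha> where \<alpha>: "\<And>i y. i < N \<Longrightarrow> y \<in> {\<alpha> i..\<alpha> i + \<eta>} \<Longrightarrow> \<bar>y\<bar> \<le> sqrt s \<and> \<bar>x i - y\<bar> \<le> 2 * sqrt (t - s)"
      by (metis lessThan_iff)
    let ?c = "heat_const N * (t - s) powr (- real N / 2) * (K * s powr (- real N / 2)) powr p"
    have "?C * (1 / s) = heat_const N * (K powr p * t powr (- real N / 2) * (B / s))" by simp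
    also have "\<dots> \<le> heat_const N * (((t - s) powr (- real N / 2) * (K * s powr (- real N / 2)) powr p) * \<eta> ^ (N - 1))"
      unfolding \<eta>_def using heat_const_pos[of N] s t B
      by (intro mult_left_mono step_exponents[OF s0 s(2) K N p]) auto
    also have "\<dots> = ?c * \<eta> ^ (N - 1)" by (simp only: ac_simps)
    finally have "ennreal (?C * (1 / s)) \<le> ennreal (?c * \<eta> ^ (N - 1))" by (rule ennreal_leI)
    also have "\<dots> \<le> (\<integral>\<^sup>+ y'. ennreal (Gker N x (bdpt N y') (t - s) * (u (bdpt N y') s) powr p) \<partial>lebN (N - 1))"
    proof (rule nn_integral_box_ge)
      show "0 \<le> \<eta>" using s s0 by (simp add: \<eta>_def)
      show "0 \<le> ?c" using heat_const_pos[of N] by simp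
    next
      fix y assume y: "y \<in> boxN (N - 1) \<alpha> \<eta>"
      have yi: "\<bar>y i\<bar> \<le> sqrt s \<and> \<bar>x i - y i\<bar> \<le> 2 * sqrt (t - s)" if "i < N - 1" for i
        by (rule \<alpha>) (use that y in \<open>auto simp: boxN_def PiE_iff\<close>)
      have bd: "bdpt N y \<in> bdcube N (sqrt s)"
        using y N yi s0 unfolding bdcube_def halfD_def bdpt_def
        by (auto simp: space_PiM PiE_iff extensional_def boxN_def)
      \<comment> \<open>In the last coordinate both x and \<open>bdpt N y\<close> vanish, so the
        distance condition holds there too.\<close>
      have "heat_const N * (t - s) powr (- real N / 2) \<le> Gker N x (bdpt N y) (t - s)"
        using s yi x by (intro Gker_ge) (auto simp: bdpt_def bdcube_def)
      moreover have "(K * s powr (- real N / 2)) powr p \<le> u (bdpt N y) s powr p"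
        using K p s t bd by (intro powr_mono2 low) auto
      ultimately show "ennreal ?c \<le> ennreal (Gker N x (bdpt N y) (t - s) * u (bdpt N y) s powr p)"
        by (intro ennreal_leI mult_mono) (auto simp: Gker_def GammaN_nonneg)
    qed
    finally show ?thesis .
  qed
  have "ennreal (?C * ln (a' / a)) = ennreal ?C * (\<integral>\<^sup>+ s. ennreal (1 / s) * indicator {a..a'} s \<partial>lborel)"
    using C a by (simp add: nn_integral_inverse ennreal_mult)
  also have "\<dots> = (\<integral>\<^sup>+ s. ennreal ?C * (ennreal (1 / s) * indicator {a..a'} s) \<partial>lborel)"
    by (rule nn_integral_cmult[symmetric]) measurable
  also have "\<dots> \<le> Duhamel N p u x t"
    unfolding Duhamel_def
  \<comment> \<open>If a' = t, the endpoint s = t lies in [a, a'] but outside the open interval of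
    \<open>Duhamel\<close>, so the comparison holds only off the null set {t}.\<close>
  proof (rule nn_integral_mono_AE)
    show "AE s in lborel. ennreal ?C * (ennreal (1 / s) * indicator {a..a'} s)
       \<le> indicator {0<..<t} s * (\<integral>\<^sup>+ y'. ennreal (Gker N x (bdpt N y') (t - s) * (u (bdpt N y') s) powr p) \<partial>lebN (N - 1))"
      using AE_lborel_singleton[of t]
    proof eventually_elim
      case (elim s)
      show ?case
      proof (cases "s \<in> {a..a'}")
        case True
        then have "a \<le> s" "s < t" "0 < s" using elim t a by auto
        then show ?thesis using True inner[of s] C by (simp add: ennreal_mult[symmetric])
      qed simp
    qed
  qed
  also have "\<dots> \<le> ennreal (u x t)"
    using solution_ge(2)[OF sol tT t0] x by (auto simp: bdcube_def)
  finally have "?C * ln (a' / a) \<le> u x t"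
    using solution_ge(3)[OF sol tT t0] x by (simp add: bdcube_def)
  then show ?thesis by (simp add: ac_simps)
qed

text \<open>If the bound failed, the solution could be doubled infinitely often before time L: the
  logarithmic times needed form a geometric series whose sum is below ln (L / a). Then u at time L
  would exceed every 2^k m L^(-N/2), although L < T makes it a real number.\<close>

lemma no_lower_bound:
  assumes sol: "is_solution N p f T u" and LT: "ereal L < T"
    and N: "N \<ge> 1" and p: "p > 1" and m: "m > 0" and a: "0 < a" "a \<le> L" and B0: "B > 0"
    and B: "\<And>s. a \<le> s \<Longrightarrow> s \<le> L \<Longrightarrow> B \<le> s powr ((1 - real N * (p - 1)) / 2)"
    and low: "\<And>s y. a \<le> s \<Longrightarrow> s \<le> L \<Longrightarrow> y \<in> bdcube N (sqrt s) \<Longrightarrow> m * s powr (- real N / 2) \<le> u y s"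
  shows "heat_const N * B * m powr (p - 1) * ln (L / a) \<le> 2 / (1 - 2 powr (1 - p))"
proof (rule ccontr)
  assume neg: "\<not> ?thesis"
  let ?c = "heat_const N * B"
  have c: "?c > 0" using heat_const_pos[of N] B0 by simp
  define q where "q = 2 powr (1 - p)"
  have q: "0 < q" "q < 1" using p by (auto simp: q_def powr_less_one)
  \<comment> \<open>With K = 2^j m and c the product of \<open>heat_const N\<close> and B, doubling
    K requires c K^p ln (a'/a) = 2 K, that is ln (a'/a) = 2 K^(1 - p) / c = 2 q^j m^(1 - p) / c. So
    \<open>lg k\<close> is the logarithmic time spent on k doublings.\<close>
  define lg where "lg k = (\<Sum>j<k. 2 * q ^ j * m powr (1 - p) / ?c)" for k :: nat
  define \<tau> where "\<tau> k = a * exp (lg k)" for k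
  have d0: "0 \<le> 2 * q ^ j * m powr (1 - p) / ?c" for j using q c by simp
  have l0: "lg k \<ge> 0" for k unfolding lg_def by (intro sum_nonneg) (use d0 in auto)
  have lL: "lg k < ln (L / a)" for k
  proof -
    have "(\<Sum>j<k. q ^ j) \<le> (\<Sum>j. q ^ j)"
      by (rule sum_le_suminf) (use q in auto)
    also have "\<dots> = 1 / (1 - q)" using q by (simp add: suminf_geometric)
    finally have "2 * m powr (1 - p) / ?c * (\<Sum>j<k. q ^ j) \<le> 2 * m powr (1 - p) / ?c * (1 / (1 - q))"
      using c by (intro mult_left_mono) auto
    also have "2 * m powr (1 - p) / ?c * (\<Sum>j<k. q ^ j) = lg k"
      unfolding lg_def sum_distrib_left by (intro sum.cong) (auto simp: field_simps)
    also have "2 * m powr (1 - p) / ?c * (1 / (1 - q)) < ln (L / a)"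
    proof -
      have "2 / (1 - q) < ?c * m powr (p - 1) * ln (L / a)"
        using neg by (simp add: q_def)
      then have "m powr (1 - p) / ?c * (2 / (1 - q)) < m powr (1 - p) / ?c * (?c * m powr (p - 1) * ln (L / a))"
        using c m by (intro mult_strict_left_mono) auto
      also have "\<dots> = (m powr (1 - p) * m powr (p - 1)) * ln (L / a)"
        using B0 heat_const_pos[of N] by simp
      also have "m powr (1 - p) * m powr (p - 1) = 1"
        using m by (simp add: powr_add[symmetric])
      finally show ?thesis by (simp add: ac_simps)
    qed
    finally show ?thesis .
  qed
  have tau: "a \<le> \<tau> k" "\<tau> k \<le> L" "\<tau> k \<le> \<tau> (Suc k)" for k
  proof -
    show "a \<le> \<tau> k" using l0[of k] a by (simp add: \<tau>_def)
    have "a * exp (lg k) \<le> a * exp (ln (L / a))"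
      using lL[of k] a by (intro mult_left_mono) (simp_all only: exp_le_cancel_iff less_imp_le)
    also have "\<dots> = L" using a by simp
    finally show "\<tau> k \<le> L" by (simp add: \<tau>_def)
    show "\<tau> k \<le> \<tau> (Suc k)" using a d0[of k] by (simp add: \<tau>_def lg_def)
  qed
  have lowk: "2 ^ k * m * s powr (- real N / 2) \<le> u y s"
    if "\<tau> k \<le> s" "s \<le> L" "y \<in> bdcube N (sqrt s)" for k s y
    using that
  proof (induction k arbitrary: s y)
    case 0
    then show ?case using low by (simp add: \<tau>_def lg_def)
  next
    case (Suc k)
    have "?c * (2 ^ k * m) powr p * ln (\<tau> (Suc k) / \<tau> k) = 2 ^ Suc k * m"
    proof -
      have "ln (\<tau> (Suc k) / \<tau> k) = 2 * q ^ k * m powr (1 - p) / ?c"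
        using a by (simp add: \<tau>_def lg_def exp_diff[symmetric])
      moreover have "(2 ^ k * m) powr p = (2 ^ k) powr p * m powr p"
        using m by (simp add: powr_mult)
      moreover have "q ^ k = (2 ^ k) powr (1 - p)"
        by (simp add: q_def powr_realpow[symmetric] powr_powr mult.commute)
      ultimately have "?c * (2 ^ k * m) powr p * ln (\<tau> (Suc k) / \<tau> k)
        = 2 * ((2 ^ k) powr p * (2 ^ k) powr (1 - p)) * (m powr p * m powr (1 - p))"
        using B0 heat_const_pos[of N] by simp
      also have "\<dots> = 2 ^ Suc k * m" using m by (simp add: powr_add[symmetric])
      finally show ?thesis .
    qed
    moreover have "?c * (2 ^ k * m) powr p * ln (\<tau> (Suc k) / \<tau> k) * s powr (- real N / 2) \<le> u y s"
    proof (rule solution_lower_step[OF sol LT N p])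
      show "0 < \<tau> k" using a by (simp add: \<tau>_def)
      show "B \<le> s powr ((1 - real N * (p - 1)) / 2)" if "\<tau> k \<le> s" "s \<le> L" for s
        by (rule B) (use that tau(1)[of k] in auto)
    qed (use m B0 tau Suc in auto)
    ultimately show ?case by simp
  qed
  \<comment> \<open>All the bounds are compared at one point, the origin, at the common time
    L.\<close>
  define z where "z = restrict (\<lambda>_. 0::real) {..<N}"
  have z: "z \<in> bdcube N (sqrt L)" unfolding z_def by (rule bdcube_zero) (use N a in auto)
  have "m * L powr (- real N / 2) > 0" using m a by simp
  then obtain k where "u z L / (m * L powr (- real N / 2)) < 2 ^ k"
    using real_arch_pow[of 2] by auto
  then show False
    using lowk[of k L z] z tau(2)[of k] \<open>m * L powr (- real N / 2) > 0\<close> by (simp add: field_simps)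
qed

section \<open>Growth of the mass of the weight in cubes\<close>

lemma normN_le:
  assumes "R \<ge> 0" and y: "\<And>i. i < N \<Longrightarrow> \<bar>y i\<bar> \<le> R"
  shows "normN N y \<le> sqrt (real N) * R"
proof -
  have "(\<Sum>i<N. (y i)^2) \<le> (\<Sum>i<N. R^2)"
    using assms by (intro sum_mono) (auto simp: abs_le_square_iff[symmetric])
  then have "normN N y \<le> sqrt (real N * R^2)" by (simp add: normN_def)
  then show ?thesis using assms by (simp add: real_sqrt_mult)
qed

lemma weight_ge:
  assumes "A \<ge> 0" "R \<ge> 1" and y: "\<And>i. i < N \<Longrightarrow> \<bar>y i\<bar> \<le> R"
  shows "((1 + sqrt (real N)) * R) powr (- A) \<le> (1 + normN N y) powr (- A)"
proof (rule powr_mono2')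
  have "normN N y \<ge> 0" by (simp add: normN_def sum_nonneg)
  then show "0 < 1 + normN N y" by simp
  show "1 + normN N y \<le> (1 + sqrt (real N)) * R"
    using normN_le[of R N y] assms by (simp add: distrib_right)
qed (use assms in auto)

lemma mass_mono:
  assumes "R \<le> R'"
  shows "mass N A R \<le> mass N A R'"
proof -
  have "boxN N (\<lambda>_. 0) R \<subseteq> boxN N (\<lambda>_. 0) R'"
    unfolding boxN_def using assms by (intro PiE_mono) auto
  then show ?thesis
    unfolding mass_def by (intro nn_integral_mono) (auto simp: indicator_def)
qed

lemma mass_ge:
  assumes "A \<ge> 0" "R \<ge> 1"
  shows "ennreal ((1 + sqrt (real N)) powr (- A) * R powr (real N - A)) \<le> mass N A R"
proof -
  have "((1 + sqrt (real N)) * R) powr (- A) * R ^ N = (1 + sqrt (real N)) powr (- A) * (R powr (- A) * R powr real N)"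
    using assms by (simp add: powr_mult powr_realpow)
  also have "\<dots> = (1 + sqrt (real N)) powr (- A) * R powr (real N - A)"
    by (simp add: powr_add[symmetric])
  finally have eq: "(1 + sqrt (real N)) powr (- A) * R powr (real N - A) = ((1 + sqrt (real N)) * R) powr (- A) * R ^ N" ..
  show ?thesis
    unfolding eq mass_def
  proof (rule nn_integral_box_ge)
    fix y assume "y \<in> boxN N (\<lambda>_. 0) R"
    then show "ennreal (((1 + sqrt (real N)) * R) powr (- A)) \<le> ennreal ((1 + normN N y) powr (- A)) * indicator (boxN N (\<lambda>_. 0) R) y"
      using weight_ge[of A R N y] assms by (auto simp: boxN_def PiE_iff intro!: ennreal_leI)
  qed (use assms in auto)
qed

text \<open>For A > N the bound of \<open>mass_ge\<close> decays in R; the mass of the unit cube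
  then gives the constant bound that the exponent 0 asks for.\<close>

lemma mass_ge_min:
  assumes "A \<ge> 0" "R \<ge> 1"
  shows "ennreal ((1 + sqrt (real N)) powr (- A) * R powr (real N - min A (real N))) \<le> mass N A R"
proof (cases "A \<le> real N")
  case True
  then show ?thesis using mass_ge[OF assms] by (simp add: min_def)
next
  case False
  then show ?thesis
    using mass_ge[of A 1 N] mass_mono[of 1 R N A] assms by (auto simp: min_def)
qed

text \<open>The larger cube contains a second box of side R, disjoint from the first. There the
  weight is at least a constant times R^(-N), which cancels the volume R^N, so the gain is
  independent of R.\<close>

lemma mass_quadruple:
  assumes "R \<ge> 1" and N: "N \<ge> 1"
  shows "mass N (real N) R + ennreal ((4 * (1 + sqrt (real N))) powr (- real N)) \<le> mass N (real N) (4 * R)"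
proof -
  \<comment> \<open>Shifting by 2 R in the last coordinate separates the boxes, as that coordinate
    is at most R in the first and at least 2 R in the second.\<close>
  define \<alpha> where "\<alpha> = (\<lambda>i. if i = N - 1 then 2 * R else 0)"
  let ?w = "\<lambda>y. ennreal ((1 + normN N y) powr (- real N))"
  let ?c = "((1 + sqrt (real N)) * (4 * R)) powr (- real N)"
  have "(S * (4 * R)) powr (- real N) * R ^ N = (4 * S) powr (- real N)" for S
  proof -
    have "(S * (4 * R)) powr (- real N) * R ^ N = (4 * S) powr (- real N) * (R powr (- real N) * R powr real N)"
      using assms by (simp add: powr_mult powr_realpow)
    also have "R powr (- real N) * R powr real N = 1"
      using assms by (simp add: powr_add[symmetric])
    finally show ?thesis by simp
  qed
  then have c: "?c * R ^ N = (4 * (1 + sqrt (real N))) powr (- real N)" .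
  have "ennreal (?c * R ^ N) \<le> (\<integral>\<^sup>+ y. ?w y * indicator (boxN N \<alpha> R) y \<partial>lebN N)"
  proof (rule nn_integral_box_ge)
    fix y assume y: "y \<in> boxN N \<alpha> R"
    have "\<bar>y i\<bar> \<le> 4 * R" if "i < N" for i
    proof -
      have "\<alpha> i \<le> y i" "y i \<le> \<alpha> i + R" using y that by (auto simp: boxN_def PiE_iff)
      then show ?thesis using assms by (auto simp: \<alpha>_def split: if_splits)
    qed
    then show "ennreal ?c \<le> ?w y * indicator (boxN N \<alpha> R) y"
      using weight_ge[of "real N" "4 * R" N y] assms y by (auto intro!: ennreal_leI)
  qed (use assms in auto)
  then have "mass N (real N) R + ennreal ((4 * (1 + sqrt (real N))) powr (- real N))
      \<le> (\<integral>\<^sup>+ y. ?w y * indicator (boxN N (\<lambda>_. 0) R) y + ?w y * indicator (boxN N \<alpha> R) y \<partial>lebN N)"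
    unfolding c mass_def by (subst nn_integral_add) (auto intro: add_left_mono)
  also have "\<dots> \<le> mass N (real N) (4 * R)"
    unfolding mass_def
  proof (rule nn_integral_mono)
    fix y
    have disj: "\<not> (y \<in> boxN N (\<lambda>_. 0) R \<and> y \<in> boxN N \<alpha> R)"
    proof
      assume y: "y \<in> boxN N (\<lambda>_. 0) R \<and> y \<in> boxN N \<alpha> R"
      have "y (N - 1) \<le> R" "\<alpha> (N - 1) \<le> y (N - 1)" using y N by (auto simp: boxN_def PiE_iff)
      then show False using assms by (simp add: \<alpha>_def)
    qed
    have sub: "y \<in> boxN N (\<lambda>_. 0) (4 * R)" if "y \<in> boxN N (\<lambda>_. 0) R \<or> y \<in> boxN N \<alpha> R"
    proof -
      have "0 \<le> y i \<and> y i \<le> 4 * R" if i: "i < N" for i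
      proof -
        have "0 \<le> y i \<and> y i \<le> R \<or> \<alpha> i \<le> y i \<and> y i \<le> \<alpha> i + R"
          using \<open>y \<in> boxN N (\<lambda>_. 0) R \<or> y \<in> boxN N \<alpha> R\<close> i by (auto simp: boxN_def PiE_iff)
        then show ?thesis using assms by (auto simp: \<alpha>_def split: if_splits)
      qed
      then show ?thesis using that by (auto simp: boxN_def PiE_iff)
    qed
    show "?w y * indicator (boxN N (\<lambda>_. 0) R) y + ?w y * indicator (boxN N \<alpha> R) y
        \<le> ?w y * indicator (boxN N (\<lambda>_. 0) (4 * R)) y"
      using disj sub by (auto simp: indicator_def)
  qed
  finally show ?thesis .
qed

text \<open>Each quadrupling of the side adds the fixed amount d, so about log R / log 4 of them
  give a logarithm. The factor 2 in the denominator pays for rounding down: log_4 R \<ge> 2 implies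
  that its integer part is at least half of it.\<close>

lemma mass_ge_log:
  assumes R: "R \<ge> 16" and N: "N \<ge> 1"
  shows "ennreal ((4 * (1 + sqrt (real N))) powr (- real N) / (2 * ln 4) * ln R) \<le> mass N (real N) R"
proof -
  define d where "d = (4 * (1 + sqrt (real N))) powr (- real N)"
  have d: "d \<ge> 0" by (simp add: d_def)
  have pow: "ennreal (real k * d) \<le> mass N (real N) (4 ^ k)" for k :: nat
  proof (induction k)
    case (Suc k)
    have "ennreal (real (Suc k) * d) = ennreal (real k * d) + ennreal d"
      using d by (simp add: ennreal_plus[symmetric] distrib_right del: ennreal_plus)
    also have "\<dots> \<le> mass N (real N) (4 ^ k) + ennreal d" using Suc by (rule add_right_mono)
    also have "\<dots> \<le> mass N (real N) (4 ^ Suc k)"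
      unfolding d_def power_Suc using N by (intro mass_quadruple) auto
    finally show ?case .
  qed simp
  define k where "k = nat \<lfloor>log 4 R\<rfloor>"
  have log2: "log 4 R \<ge> 2"
    using R le_log_iff[of 4 R 2] by (simp add: powr_numeral)
  have k: "real k \<le> log 4 R" "log 4 R < real k + 1"
    using log2 by (auto simp: k_def)
  have "4 ^ k \<le> R"
    using k(1) R by (subst (asm) le_log_iff) (auto simp: powr_realpow)
  have "d / (2 * ln 4) * ln R = (log 4 R / 2) * d" by (simp add: log_def mult.commute)
  also have "\<dots> \<le> real k * d" using k(2) log2 d by (intro mult_right_mono) auto
  finally have "ennreal (d / (2 * ln 4) * ln R) \<le> ennreal (real k * d)" by (rule ennreal_leI)
  also have "\<dots> \<le> mass N (real N) R"
    using pow[of k] mass_mono[OF \<open>4 ^ k \<le> R\<close>] by (rule order_trans)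
  finally show ?thesis by (simp add: d_def)
qed

section \<open>Life span bounds from mass bounds\<close>

lemma lifespan_le:
  assumes N: "N \<ge> 1" and p: "p > 1" and \<kappa>: "\<kappa> > 0"
    and lower: "\<And>x. x \<in> halfD N \<Longrightarrow> (1 + normN N x) powr (- A) \<le> \<phi> x"
    and a: "0 < a" "a \<le> L" and M: "M > 0" "ennreal M \<le> mass N A (sqrt a)" and B0: "B > 0"
    and B: "\<And>s. a \<le> s \<Longrightarrow> s \<le> L \<Longrightarrow> B \<le> s powr ((1 - real N * (p - 1)) / 2)"
    and large: "2 / (1 - 2 powr (1 - p)) < heat_const N * B * (heat_const N * \<kappa> * M) powr (p - 1) * ln (L / a)"
  shows "lifespan N p (\<lambda>x. \<kappa> * \<phi> x) \<le> ereal L"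
  unfolding lifespan_def
proof (rule Sup_least)
  fix T assume "T \<in> {T. 0 \<le> T \<and> (\<exists>u. is_minimal_solution N p (\<lambda>x. \<kappa> * \<phi> x) T u)}"
  then obtain u where sol: "is_solution N p (\<lambda>x. \<kappa> * \<phi> x) T u"
    by (auto simp: is_minimal_solution_def)
  show "T \<le> ereal L"
  proof (rule ccontr)
    assume "\<not> T \<le> ereal L"
    then have LT: "ereal L < T" by simp
    \<comment> \<open>The iteration starts from the constant which
      \<open>solution_lower_init\<close> provides at all times s \<ge> a.\<close>
    have "heat_const N * B * (heat_const N * \<kappa> * M) powr (p - 1) * ln (L / a) \<le> 2 / (1 - 2 powr (1 - p))"
    proof (rule no_lower_bound[OF sol LT N p _ a B0 B])
      show "0 < heat_const N * \<kappa> * M" using heat_const_pos[of N] \<kappa> M by simp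
      fix s y assume s: "a \<le> s" "s \<le> L" and y: "y \<in> bdcube N (sqrt s)"
      have "ereal s < T" using s LT by (meson ereal_less_eq(3) order_le_less_trans)
      then show "heat_const N * \<kappa> * M * s powr (- real N / 2) \<le> u y s"
        using solution_lower_init[OF sol _ a(1) s(1) \<kappa> lower M(2) _ N y] M by simp
    qed
    then show False using large by simp
  qed
qed

text \<open>The power is monotone in s, increasing or decreasing with the sign of b, so its minimum
  is at L/2 or at L; the absolute value covers both cases.\<close>

lemma powr_ge_on_dyadic:
  fixes s L b :: real
  assumes "L > 0" "L / 2 \<le> s" "s \<le> L"
  shows "2 powr (- \<bar>b\<bar>) * L powr b \<le> s powr b"
proof (cases "b \<ge> 0")
  case True
  have "2 powr (- \<bar>b\<bar>) * L powr b = (L / 2) powr b"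
    using True assms by (simp add: powr_divide powr_minus_divide)
  also have "\<dots> \<le> s powr b" using True assms by (intro powr_mono2) auto
  finally show ?thesis .
next
  case False
  have "2 powr (- \<bar>b\<bar>) * L powr b \<le> 1 * L powr b"
    using powr_mono[of "- \<bar>b\<bar>" 0 2] by (intro mult_right_mono) auto
  also have "\<dots> \<le> s powr b" using False assms by (simp add: powr_mono2')
  finally show ?thesis .
qed

text \<open>The case a = L/2 of \<open>lifespan_le\<close>, where ln (L / a) is the constant ln 2
  and the growth comes from L^b and the mass instead.\<close>

lemma lifespan_le_dyadic:
  assumes N: "N \<ge> 1" and p: "p > 1" and \<kappa>: "\<kappa> > 0"
    and lower: "\<And>x. x \<in> halfD N \<Longrightarrow> (1 + normN N x) powr (- A) \<le> \<phi> x"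
    and L: "L > 0" and M: "M > 0" "ennreal M \<le> mass N A (sqrt (L / 2))"
  defines "b \<equiv> (1 - real N * (p - 1)) / 2"
  assumes large: "2 / (1 - 2 powr (1 - p)) <
    heat_const N powr p * 2 powr (- \<bar>b\<bar>) * ln 2 * (L powr b * (\<kappa> * M) powr (p - 1))"
  shows "lifespan N p (\<lambda>x. \<kappa> * \<phi> x) \<le> ereal L"
proof (rule lifespan_le[OF N p \<kappa> lower _ _ M])
  show "0 < 2 powr (- \<bar>b\<bar>) * L powr b" using L by simp
  show "2 powr (- \<bar>b\<bar>) * L powr b \<le> s powr ((1 - real N * (p - 1)) / 2)" if "L / 2 \<le> s" "s \<le> L" for s
    using powr_ge_on_dyadic[OF L that, of b] by (simp only: b_def)
  have "heat_const N powr p = heat_const N * heat_const N powr (p - 1)"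
    using heat_const_pos[of N] powr_add[of "heat_const N" 1 "p - 1"] by simp
  moreover have "(heat_const N * \<kappa> * M) powr (p - 1) = heat_const N powr (p - 1) * (\<kappa> * M) powr (p - 1)"
    using heat_const_pos[of N] \<kappa> M by (simp add: powr_mult)
  ultimately show "2 / (1 - 2 powr (1 - p)) < heat_const N * (2 powr (- \<bar>b\<bar>) * L powr b) *
      (heat_const N * \<kappa> * M) powr (p - 1) * ln (L / (L / 2))"
    using large L by (simp add: ac_simps)
qed (use L in auto)

section \<open>Choice of L in the critical and subcritical cases\<close>

lemma exists_powr_gt:
  fixes C D r :: real
  assumes "D > 0" "r > 0"
  shows "\<exists>g>0. C < D * g powr r"
proof -
  define g where "g = ((\<bar>C\<bar> + 1) / D) powr (1 / r)"
  have "g powr r = (\<bar>C\<bar> + 1) / D" using assms by (simp add: g_def powr_powr)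
  then have "C < D * g powr r" using assms by simp
  moreover have "g > 0" using assms by (simp add: g_def)
  ultimately show ?thesis by blast
qed

lemma eventually_powr_neg_ge:
  fixes g r c :: real
  assumes "g > 0" "r > 0"
  shows "\<forall>\<^sub>F \<kappa> in at_right 0. c \<le> g * \<kappa> powr (- r)"
proof -
  have "filterlim (\<lambda>\<kappa>. g * \<kappa> powr (- r)) at_top (at_right 0)"
    using assms by real_asymp
  then show ?thesis by (simp add: filterlim_at_top)
qed

text \<open>Here N (p - 1) = 1, so b = 0 and B = 1. With a = 1 the mass is a fixed constant, and the
  factor \<kappa>^(p - 1) has to be compensated by ln L alone.\<close>

lemma critical_fast_decay:
  assumes N: "N \<ge> 1" and p: "p = 1 + 1 / real N" and A: "A \<ge> 0"
    and lower: "\<And>x. x \<in> halfD N \<Longrightarrow> (1 + normN N x) powr (- A) \<le> \<phi> x"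
  shows "\<exists>\<gamma>>0. \<forall>\<^sub>F \<kappa> in at_right 0. lifespan N p (\<lambda>x. \<kappa> * \<phi> x) \<le> ereal (exp (\<gamma> * \<kappa> powr (- (p - 1))))"
proof -
  define m where "m = (1 + sqrt (real N)) powr (- A)"
  have "1 + sqrt (real N) > 0" by (simp add: add_pos_nonneg)
  then have m: "m > 0" by (simp add: m_def)
  have p1: "p > 1" using p N by simp
  let ?h = "heat_const N"
  have D: "?h * (?h * m) powr (p - 1) > 0" using heat_const_pos[of N] m by simp
  obtain \<gamma> where \<gamma>: "\<gamma> > 0" "2 / (1 - 2 powr (1 - p)) < ?h * (?h * m) powr (p - 1) * \<gamma>"
  proof -
    obtain g where "g > 0" "2 / (1 - 2 powr (1 - p)) < ?h * (?h * m) powr (p - 1) * g powr 1"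
      using exists_powr_gt[OF D zero_less_one] by blast
    then show ?thesis using that[of g] by simp
  qed
  have "\<forall>\<^sub>F \<kappa> in at_right 0. lifespan N p (\<lambda>x. \<kappa> * \<phi> x) \<le> ereal (exp (\<gamma> * \<kappa> powr (- (p - 1))))"
    using eventually_at_right_less[of "0::real"]
  proof eventually_elim
    case (elim \<kappa>)
    have "(?h * \<kappa> * m) powr (p - 1) * \<kappa> powr (- (p - 1)) = (?h * m) powr (p - 1) * (\<kappa> powr (p - 1) * \<kappa> powr (- (p - 1)))"
      using elim m heat_const_pos[of N] by (simp add: powr_mult)
    also have "\<dots> = (?h * m) powr (p - 1)" using elim by (simp add: powr_add[symmetric])
    finally have eq: "(?h * \<kappa> * m) powr (p - 1) * \<kappa> powr (- (p - 1)) = (?h * m) powr (p - 1)" .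
    show ?case
    proof (rule lifespan_le[OF N p1 elim lower, where a=1 and M=m and B=1])
      show "ennreal m \<le> mass N A (sqrt 1)" using mass_ge[of A 1 N] A by (simp add: m_def)
      show "1 \<le> s powr ((1 - real N * (p - 1)) / 2)" if "1 \<le> s" for s :: real
        using that N by (simp add: p)
      have eq2: "?h * 1 * (?h * \<kappa> * m) powr (p - 1) * ln (exp (\<gamma> * \<kappa> powr (- (p - 1))) / 1)
         = ?h * ((?h * \<kappa> * m) powr (p - 1) * \<kappa> powr (- (p - 1))) * \<gamma>" by simp
      show "2 / (1 - 2 powr (1 - p)) < ?h * 1 * (?h * \<kappa> * m) powr (p - 1) * ln (exp (\<gamma> * \<kappa> powr (- (p - 1))) / 1)"
        unfolding eq2 eq by (rule \<gamma>(2))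
    qed (use m \<gamma> in auto)
  qed
  then show ?thesis using \<gamma> by blast
qed

text \<open>Again B = 1. With l = ln L and a = sqrt L, the mass in the cube of side exp (l/4) is at
  least e l / 4 and ln (L / a) = l / 2. The quantity to be made large is thus \<kappa>^(p - 1) l^p
  up to a constant, which fixes the order \<kappa>^(-(p - 1)/p) of l.\<close>

lemma critical_borderline_decay:
  assumes N: "N \<ge> 1" and p: "p = 1 + 1 / real N"
    and lower: "\<And>x. x \<in> halfD N \<Longrightarrow> (1 + normN N x) powr (- real N) \<le> \<phi> x"
  shows "\<exists>\<gamma>>0. \<forall>\<^sub>F \<kappa> in at_right 0. lifespan N p (\<lambda>x. \<kappa> * \<phi> x) \<le> ereal (exp (\<gamma> * \<kappa> powr (- (p - 1) / p)))"
proof -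
  define e where "e = (4 * (1 + sqrt (real N))) powr (- real N) / (2 * ln 4)"
  have "1 + sqrt (real N) > 0" by (simp add: add_pos_nonneg)
  then have e: "e > 0" by (simp add: e_def)
  have p1: "p > 1" using p N by simp
  let ?h = "heat_const N"
  let ?D = "?h / 2 * (?h * e / 4) powr (p - 1)"
  have D: "?D > 0" using heat_const_pos[of N] e by simp
  obtain \<gamma> where \<gamma>: "\<gamma> > 0" "2 / (1 - 2 powr (1 - p)) < ?D * \<gamma> powr p"
    using exists_powr_gt[OF D, of p "2 / (1 - 2 powr (1 - p))"] p1 by fastforce
  \<comment> \<open>This makes the side exp (l/4) at least 16, as \<open>mass_ge_log\<close>
    requires.\<close>
  have ev: "\<forall>\<^sub>F \<kappa> in at_right 0. 4 * ln 16 \<le> \<gamma> * \<kappa> powr (- ((p - 1) / p))"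
    using \<gamma> p1 by (intro eventually_powr_neg_ge) auto
  have "\<forall>\<^sub>F \<kappa> in at_right 0. lifespan N p (\<lambda>x. \<kappa> * \<phi> x) \<le> ereal (exp (\<gamma> * \<kappa> powr (- (p - 1) / p)))"
    using ev eventually_at_right_less[of "0::real"]
  proof eventually_elim
    case (elim \<kappa>)
    define l where "l = \<gamma> * \<kappa> powr (- (p - 1) / p)"
    have l: "4 * ln 16 \<le> l" using elim(1) by (simp only: l_def minus_divide_left)
    have "ln (16::real) > 0" by simp
    then have l0: "l > 0" using l by linarith
    have "\<kappa> powr (p - 1) * l powr p = \<gamma> powr p * (\<kappa> powr (p - 1) * \<kappa> powr (- (p - 1)))"
      using p1 elim(2) \<gamma> by (simp add: l_def powr_mult powr_powr)
    also have "\<dots> = \<gamma> powr p" using elim(2) by (simp add: powr_add[symmetric])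
    finally have kl: "\<kappa> powr (p - 1) * l powr p = \<gamma> powr p" .
    have "lifespan N p (\<lambda>x. \<kappa> * \<phi> x) \<le> ereal (exp l)"
    proof (rule lifespan_le[OF N p1 elim(2) lower, where a="exp (l / 2)" and M="e * (l / 4)" and B=1])
      have "exp (l / 4) \<ge> exp (ln 16)" using l unfolding exp_le_cancel_iff by simp
      then have 16: "exp (l / 4) \<ge> 16" by simp
      have "sqrt (exp (l / 2)) = exp (l / 4)"
        by (rule real_sqrt_unique) (auto simp: exp_double[symmetric])
      then show "ennreal (e * (l / 4)) \<le> mass N (real N) (sqrt (exp (l / 2)))"
        using mass_ge_log[OF 16 N] by (simp add: e_def)
      show "1 \<le> s powr ((1 - real N * (p - 1)) / 2)" if "exp (l / 2) \<le> s" for s :: real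
        using that N by (auto simp: p intro: order_less_le_trans[OF exp_gt_zero])
      have "(?h * \<kappa> * (e * (l / 4))) powr (p - 1) = (?h * e / 4) powr (p - 1) * (\<kappa> powr (p - 1) * l powr (p - 1))"
        using elim(2) l0 e heat_const_pos[of N] by (simp add: powr_mult[symmetric] ac_simps)
      moreover have "ln (exp l / exp (l / 2)) = l / 2" by (simp add: exp_diff[symmetric])
      moreover have "l powr p = l powr (p - 1) * l" using l0 powr_add[of l "p - 1" 1] by simp
      ultimately have eq: "?h * 1 * (?h * \<kappa> * (e * (l / 4))) powr (p - 1) * ln (exp l / exp (l / 2)) = ?D * \<gamma> powr p"
        by (simp add: kl[symmetric])
      show "2 / (1 - 2 powr (1 - p)) < ?h * 1 * (?h * \<kappa> * (e * (l / 4))) powr (p - 1) * ln (exp l / exp (l / 2))"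
        unfolding eq by (rule \<gamma>(2))
    qed (use l0 e in auto)
    then show ?case by (simp add: l_def)
  qed
  then show ?thesis using \<gamma> by blast
qed

text \<open>The mass is at least of order L^\<beta>, so the quantity to be made large is L^b
  (\<kappa> L^\<beta>)^(p - 1) = (\<kappa> L^\<theta>)^(p - 1) up to a constant. This fixes L as a
  multiple of \<kappa>^(-1/\<theta>), where \<theta> > 0 by the assumption on min A N.\<close>

lemma subcritical_power:
  assumes N: "N \<ge> 1" and p: "p > 1" and A: "A \<ge> 0"
    and sub: "min A (real N) < 1 / (p - 1)"
    and lower: "\<And>x. x \<in> halfD N \<Longrightarrow> (1 + normN N x) powr (- A) \<le> \<phi> x"
  shows "\<exists>\<gamma>>0. \<forall>\<^sub>F \<kappa> in at_right 0. lifespan N p (\<lambda>x. \<kappa> * \<phi> x) \<le>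
    ereal (\<gamma> * \<kappa> powr (- inverse (1 / (2 * (p - 1)) - min A (real N) / 2)))"
proof -
  define \<theta> where "\<theta> = 1 / (2 * (p - 1)) - min A (real N) / 2"
  have \<theta>: "\<theta> > 0" using sub p by (simp add: \<theta>_def field_simps)
  define m where "m = (1 + sqrt (real N)) powr (- A)"
  have "1 + sqrt (real N) > 0" by (simp add: add_pos_nonneg)
  then have m: "m > 0" by (simp add: m_def)
  define b where "b = (1 - real N * (p - 1)) / 2"
  define \<beta> where "\<beta> = (real N - min A (real N)) / 2"
  have exps: "b + \<beta> * (p - 1) = \<theta> * (p - 1)"
    using p by (simp add: b_def \<beta>_def \<theta>_def field_simps)
  define D where "D = heat_const N powr p * 2 powr (- \<bar>b\<bar>) * ln 2 * (m * 2 powr (- \<beta>)) powr (p - 1)"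
  have D: "D > 0" using heat_const_pos[of N] m by (simp add: D_def)
  obtain \<gamma> where \<gamma>: "\<gamma> > 0" "2 / (1 - 2 powr (1 - p)) < D * \<gamma> powr (\<theta> * (p - 1))"
    using exists_powr_gt[OF D, of "\<theta> * (p - 1)"] p \<theta> by auto
  \<comment> \<open>L \<ge> 2 makes the side sqrt (L/2) at least 1, as \<open>mass_ge_min\<close>
    requires.\<close>
  have ev: "\<forall>\<^sub>F \<kappa> in at_right 0. 2 \<le> \<gamma> * \<kappa> powr (- inverse \<theta>)"
    using \<gamma> \<theta> by (intro eventually_powr_neg_ge) auto
  have "\<forall>\<^sub>F \<kappa> in at_right 0. lifespan N p (\<lambda>x. \<kappa> * \<phi> x) \<le> ereal (\<gamma> * \<kappa> powr (- inverse \<theta>))"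
    using ev eventually_at_right_less[of "0::real"]
  proof eventually_elim
    case (elim \<kappa>)
    define L where "L = \<gamma> * \<kappa> powr (- inverse \<theta>)"
    have L: "L \<ge> 2" using elim by (simp add: L_def)
    define M where "M = m * (L / 2) powr \<beta>"
    have "lifespan N p (\<lambda>x. \<kappa> * \<phi> x) \<le> ereal L"
    proof (rule lifespan_le_dyadic[OF N p elim(2) lower, where M=M])
      show "M > 0" using m L by (simp add: M_def)
      have "sqrt (L / 2) powr (real N - min A (real N)) = (L / 2) powr \<beta>"
        using L by (simp add: powr_half_sqrt[symmetric] powr_powr \<beta>_def)
      moreover have "sqrt (L / 2) \<ge> 1" using L by simp
      ultimately show "ennreal M \<le> mass N A (sqrt (L / 2))"
        using mass_ge_min[of A "sqrt (L / 2)" N] A by (simp add: M_def m_def)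
      have "(\<kappa> * M) powr (p - 1) = ((m * 2 powr (- \<beta>)) * (\<kappa> * L powr \<beta>)) powr (p - 1)"
        using L by (simp add: M_def powr_divide powr_minus_divide ac_simps)
      also have "\<dots> = (m * 2 powr (- \<beta>)) powr (p - 1) * (\<kappa> powr (p - 1) * L powr (\<beta> * (p - 1)))"
        using m elim L by (simp add: powr_mult powr_powr)
      finally have "L powr b * (\<kappa> * M) powr (p - 1)
          = (m * 2 powr (- \<beta>)) powr (p - 1) * (\<kappa> powr (p - 1) * (L powr b * L powr (\<beta> * (p - 1))))"
        by simp
      also have "L powr b * L powr (\<beta> * (p - 1)) = L powr (\<theta> * (p - 1))"
        by (simp add: powr_add[symmetric] exps)
      also have "\<dots> = \<gamma> powr (\<theta> * (p - 1)) * \<kappa> powr (- (p - 1))"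
      proof -
        have "- inverse \<theta> * (\<theta> * (p - 1)) = - (p - 1)" using \<theta> by (simp add: field_simps)
        then have "(\<kappa> powr - inverse \<theta>) powr (\<theta> * (p - 1)) = \<kappa> powr (- (p - 1))"
          by (simp only: powr_powr)
        then show ?thesis by (simp add: L_def powr_mult)
      qed
      also have "\<kappa> powr (p - 1) * (\<gamma> powr (\<theta> * (p - 1)) * \<kappa> powr (- (p - 1)))
        = \<gamma> powr (\<theta> * (p - 1)) * (\<kappa> powr (p - 1) * \<kappa> powr (- (p - 1)))" by simp
      also have "\<kappa> powr (p - 1) * \<kappa> powr (- (p - 1)) = 1"
        using elim by (simp add: powr_add[symmetric])
      finally have "heat_const N powr p * 2 powr (- \<bar>b\<bar>) * ln 2 * (L powr b * (\<kappa> * M) powr (p - 1)) = D * \<gamma> powr (\<theta> * (p - 1))"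
        by (simp add: D_def)
      then show "2 / (1 - 2 powr (1 - p)) < heat_const N powr p * 2 powr (- \<bar>(1 - real N * (p - 1)) / 2\<bar>) * ln 2 *
          (L powr ((1 - real N * (p - 1)) / 2) * (\<kappa> * M) powr (p - 1))"
        using \<gamma> by (simp only: b_def)
    qed (use L in auto)
    then show ?case by (simp add: L_def)
  qed
  then show ?thesis using \<gamma> unfolding \<theta>_def by blast
qed

text \<open>Now the mass is at least of order ln L, so \<kappa> L^\<theta> ln L has to be large.
  With z = 1/\<kappa> and L^\<theta> = \<gamma>^\<theta> z / ln z this product is \<gamma>^\<theta>
  ln L / ln z, and ln L / ln z stays above 1 / (2 \<theta>) for small \<kappa>.\<close>

lemma subcritical_log:
  assumes N: "N \<ge> 1" and p: "p > 1"
    and sub: "real N < 1 / (p - 1)"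
    and lower: "\<And>x. x \<in> halfD N \<Longrightarrow> (1 + normN N x) powr (- real N) \<le> \<phi> x"
  shows "\<exists>\<gamma>>0. \<forall>\<^sub>F \<kappa> in at_right 0. lifespan N p (\<lambda>x. \<kappa> * \<phi> x) \<le>
    ereal (\<gamma> * (inverse \<kappa> / ln (inverse \<kappa>)) powr inverse (1 / (2 * (p - 1)) - real N / 2))"
proof -
  define \<theta> where "\<theta> = 1 / (2 * (p - 1)) - real N / 2"
  have \<theta>: "\<theta> > 0" using sub p by (simp add: \<theta>_def field_simps)
  define e where "e = (4 * (1 + sqrt (real N))) powr (- real N) / (2 * ln 4)"
  have "1 + sqrt (real N) > 0" by (simp add: add_pos_nonneg)
  then have e: "e > 0" by (simp add: e_def)
  define b where "b = (1 - real N * (p - 1)) / 2"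
  have b: "b = \<theta> * (p - 1)" using p by (simp add: b_def \<theta>_def field_simps)
  \<comment> \<open>The divisor 8 \<theta> is the 4 in the mass bound e ln L / 4 times the 2
    \<theta> in the lower bound for ln L / ln z.\<close>
  define D where "D = heat_const N powr p * 2 powr (- \<bar>b\<bar>) * ln 2 * (e / (8 * \<theta>)) powr (p - 1)"
  have D: "D > 0" using heat_const_pos[of N] e \<theta> by (simp add: D_def)
  obtain \<gamma> where \<gamma>: "\<gamma> > 0" "2 / (1 - 2 powr (1 - p)) < D * \<gamma> powr (\<theta> * (p - 1))"
    using exists_powr_gt[OF D, of "\<theta> * (p - 1)"] p \<theta> by auto
  \<comment> \<open>The right-hand side is ln L. Half of its leading term ln (1/\<kappa>) / \<theta>
    absorbs ln \<gamma> and the iterated logarithm.\<close>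
  have ev1: "\<forall>\<^sub>F \<kappa> in at_right 0. ln (inverse \<kappa>) / (2 * \<theta>) \<le> ln \<gamma> + inverse \<theta> * (ln (inverse \<kappa>) - ln (ln (inverse \<kappa>)))"
    using \<theta> by real_asymp
  \<comment> \<open>512 = 2 * 16^2, so that L \<ge> 512 gives the side sqrt (L/2) \<ge> 16 for
    \<open>mass_ge_log\<close>.\<close>
  have ev2: "\<forall>\<^sub>F \<kappa> in at_right 0. ln (inverse \<kappa>) / (2 * \<theta>) \<ge> ln (512::real)"
    using \<theta> by real_asymp
  have ev3: "\<forall>\<^sub>F \<kappa> in at_right 0. ln (inverse \<kappa>) > (0::real)"
    by real_asymp
  have "\<forall>\<^sub>F \<kappa> in at_right 0. lifespan N p (\<lambda>x. \<kappa> * \<phi> x) \<le> ereal (\<gamma> * (inverse \<kappa> / ln (inverse \<kappa>)) powr inverse \<theta>)"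
    using ev1 ev2 ev3 eventually_at_right_less[of "0::real"]
  proof eventually_elim
    case (elim \<kappa>)
    define z where "z = inverse \<kappa>"
    define L where "L = \<gamma> * (z / ln z) powr inverse \<theta>"
    have z: "ln z > 0" "z > 0" using elim by (auto simp: z_def)
    have L0: "L > 0" using \<gamma> z by (simp add: L_def)
    have "ln L = ln \<gamma> + inverse \<theta> * (ln z - ln (ln z))"
      using \<gamma> z by (simp add: L_def ln_mult ln_powr ln_div)
    then have lnL: "ln z / (2 * \<theta>) \<le> ln L" and "ln 512 \<le> ln L"
      using elim by (auto simp: z_def)
    then have L: "L \<ge> 512" using L0 by simp
    define M where "M = e * (ln L / 4)"
    have "lifespan N p (\<lambda>x. \<kappa> * \<phi> x) \<le> ereal L"
    proof (rule lifespan_le_dyadic[OF N p elim(4) lower L0, where M=M])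
      show "M > 0" using e L by (simp add: M_def)
      have "sqrt (L / 2) \<ge> sqrt (16 ^ 2)" using L by (intro real_sqrt_le_mono) simp
      then have s: "sqrt (L / 2) \<ge> 16" by simp
      \<comment> \<open>ln (sqrt (L/2)) = (ln L - ln 2) / 2 is at least ln L / 4 exactly when ln L
        \<ge> 2 ln 2 = ln 4.\<close>
      have "ln 4 \<le> ln L" using L by simp
      moreover have "ln (4::real) = 2 * ln 2" using ln_realpow[of 2 2] by simp
      ultimately have "ln L / 4 \<le> ln (sqrt (L / 2))"
        using L by (simp add: ln_sqrt ln_div)
      then have "M \<le> e * ln (sqrt (L / 2))" using e by (simp add: M_def)
      then show "ennreal M \<le> mass N (real N) (sqrt (L / 2))"
        using mass_ge_log[OF s N] by (auto simp: e_def intro: order_trans[OF ennreal_leI])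
      have Lt: "L powr \<theta> = \<gamma> powr \<theta> * (z / ln z)"
        using \<gamma> \<theta> z by (simp add: L_def powr_mult powr_powr)
      have "L powr b * (\<kappa> * M) powr (p - 1) = (L powr \<theta>) powr (p - 1) * (\<kappa> * M) powr (p - 1)"
        by (simp add: b powr_powr)
      also have "\<dots> = (L powr \<theta> * (\<kappa> * M)) powr (p - 1)"
        using elim \<open>M > 0\<close> by (simp add: powr_mult)
      also have "L powr \<theta> * (\<kappa> * M) = \<gamma> powr \<theta> * (e * (ln L / ln z) / 4)"
        using elim(4) by (simp add: Lt M_def z_def)
      finally have eq: "L powr b * (\<kappa> * M) powr (p - 1) = (\<gamma> powr \<theta> * (e * (ln L / ln z) / 4)) powr (p - 1)" .
      have "1 / (2 * \<theta>) \<le> ln L / ln z" using lnL z \<theta> by (simp add: field_simps)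
      then have "e * (1 / (2 * \<theta>)) / 4 \<le> e * (ln L / ln z) / 4" using e by (intro divide_right_mono mult_left_mono) auto
      then have "\<gamma> powr \<theta> * (e / (8 * \<theta>)) \<le> \<gamma> powr \<theta> * (e * (ln L / ln z) / 4)"
        by (intro mult_left_mono) auto
      then have "(\<gamma> powr \<theta> * (e / (8 * \<theta>))) powr (p - 1) \<le> L powr b * (\<kappa> * M) powr (p - 1)"
        unfolding eq using p e \<theta> by (intro powr_mono2) auto
      also have "(\<gamma> powr \<theta> * (e / (8 * \<theta>))) powr (p - 1) = \<gamma> powr (\<theta> * (p - 1)) * (e / (8 * \<theta>)) powr (p - 1)"
        by (subst powr_mult) (simp add: powr_powr)
      finally have le: "(heat_const N powr p * 2 powr (- \<bar>b\<bar>) * ln 2) * (\<gamma> powr (\<theta> * (p - 1)) * (e / (8 * \<theta>)) powr (p - 1))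
        \<le> (heat_const N powr p * 2 powr (- \<bar>b\<bar>) * ln 2) * (L powr b * (\<kappa> * M) powr (p - 1))"
        by (intro mult_left_mono) auto
      have "D * \<gamma> powr (\<theta> * (p - 1)) = (heat_const N powr p * 2 powr (- \<bar>b\<bar>) * ln 2) * (\<gamma> powr (\<theta> * (p - 1)) * (e / (8 * \<theta>)) powr (p - 1))"
        by (simp add: D_def)
      then show "2 / (1 - 2 powr (1 - p)) < heat_const N powr p * 2 powr (- \<bar>(1 - real N * (p - 1)) / 2\<bar>) * ln 2 *
          (L powr ((1 - real N * (p - 1)) / 2) * (\<kappa> * M) powr (p - 1))"
        using \<gamma>(2) le by (simp only: b_def[symmetric])
    qed
    then show ?case by (simp only: L_def z_def)
  qed
  then show ?thesis using \<gamma> unfolding \<theta>_def by blast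
qed

theorem theorem6p7:
  fixes N :: nat and p A :: real and \<phi> :: "(nat \<Rightarrow> real) \<Rightarrow> real"
  assumes N: "N \<ge> 1" and p: "p > 1" and A: "A > 0"
    and meas: "\<phi> \<in> borel_measurable (lebN N)"
    and Linf: "\<exists>C. AE x in lebN N. x \<in> halfD N \<longrightarrow> \<bar>\<phi> x\<bar> \<le> C"
    and nonneg: "\<forall>x \<in> halfD N. 0 \<le> \<phi> x"
    and lower: "\<forall>x \<in> halfD N. \<phi> x \<ge> (1 + normN N x) powr (- A)"
  shows
    "(p = 1 + 1 / real N \<and> A \<ge> real N \<longrightarrow>
       (\<exists>\<gamma> > 0. \<forall>\<^sub>F \<kappa> in at_right 0.
          (A > real N \<longrightarrow>
             lifespan N p (\<lambda>x. \<kappa> * \<phi> x) \<le> ereal (exp (\<gamma> * \<kappa> powr (- (p - 1))))) \<and>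
          (A = real N \<longrightarrow>
             lifespan N p (\<lambda>x. \<kappa> * \<phi> x) \<le> ereal (exp (\<gamma> * \<kappa> powr (- (p - 1) / p))))))
     \<and>
     ((p < 1 + 1 / real N \<or> A < 1 / (p - 1)) \<longrightarrow>
       (\<exists>\<gamma>' > 0. \<forall>\<^sub>F \<kappa> in at_right 0.
          (A \<noteq> real N \<longrightarrow>
             lifespan N p (\<lambda>x. \<kappa> * \<phi> x) \<le>
               ereal (\<gamma>' * \<kappa> powr (- inverse (1 / (2 * (p - 1)) - min A (real N) / 2)))) \<and>
          (A = real N \<longrightarrow>
             lifespan N p (\<lambda>x. \<kappa> * \<phi> x) \<le>
               ereal (\<gamma>' * (inverse \<kappa> / ln (inverse \<kappa>)) powr inverse (1 / (2 * (p - 1)) - real N / 2)))))"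
proof (intro conjI impI)
  have low: "\<And>x. x \<in> halfD N \<Longrightarrow> (1 + normN N x) powr (- A) \<le> \<phi> x" using lower by blast
  {
    assume crit: "p = 1 + 1 / real N \<and> A \<ge> real N"
    show "\<exists>\<gamma> > 0. \<forall>\<^sub>F \<kappa> in at_right 0.
          (A > real N \<longrightarrow>
             lifespan N p (\<lambda>x. \<kappa> * \<phi> x) \<le> ereal (exp (\<gamma> * \<kappa> powr (- (p - 1))))) \<and>
          (A = real N \<longrightarrow>
             lifespan N p (\<lambda>x. \<kappa> * \<phi> x) \<le> ereal (exp (\<gamma> * \<kappa> powr (- (p - 1) / p))))"
    \<comment> \<open>A is fixed, so only one of the two implications is not vacuous and \<gamma>
      may be taken from that case.\<close>
    proof (cases "A = real N")
      case True
      then show ?thesis using critical_borderline_decay[of N p \<phi>] N crit low by simp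
    next
      case False
      then show ?thesis using critical_fast_decay[of N p A \<phi>] N crit low A by simp
    qed
  next
    assume sub: "p < 1 + 1 / real N \<or> A < 1 / (p - 1)"
    have "real N < 1 / (p - 1)" if "p < 1 + 1 / real N"
    proof -
      have "(p - 1) * real N < 1" using that N by (simp add: field_simps)
      then show ?thesis using p by (simp add: pos_less_divide_eq mult.commute)
    qed
    \<comment> \<open>Both alternatives of the assumption give this one condition, which for A = N
      reads N < 1 / (p - 1).\<close>
    then have m: "min A (real N) < 1 / (p - 1)" using sub by linarith
    show "\<exists>\<gamma>' > 0. \<forall>\<^sub>F \<kappa> in at_right 0.
          (A \<noteq> real N \<longrightarrow>
             lifespan N p (\<lambda>x. \<kappa> * \<phi> x) \<le>
               ereal (\<gamma>' * \<kappa> powr (- inverse (1 / (2 * (p - 1)) - min A (real N) / 2)))) \<and>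
          (A = real N \<longrightarrow>
             lifespan N p (\<lambda>x. \<kappa> * \<phi> x) \<le>
               ereal (\<gamma>' * (inverse \<kappa> / ln (inverse \<kappa>)) powr inverse (1 / (2 * (p - 1)) - real N / 2)))"
    proof (cases "A = real N")
      case True
      then show ?thesis using subcritical_log[of N p \<phi>] N p m low by simp
    next
      case False
      then show ?thesis using subcritical_power[of N p A \<phi>] N p m low A by simp
    qed
  }
qed

end
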